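(* Let $r,\nu\in(0,\infty)$ and $p\in(0,1)$. If either ($pr^{\nu}<1$ and $r>1$) or $r\le 1$, then the $\mathrm{CMNB}(r,\nu,p)$ distribution is a discrete pseudo compound Poisson distribution.
   Context: For $r,\nu\in(0,\infty)$ and $p\in(0,1)$, a random variable $X$ follows the COM-negative binomial distribution $\mathrm{CMNB}(r,\nu,p)$ if $$\mathrm{P}(X=k)=\left(\frac{\Gamma(r+k)}{k!\,\Gamma(r)}\right)^{\nu}p^k(1-p)^r\frac{1}{C(r,\nu,p)},\quad k=0,1,2,\ldots,\qquad C(r,\nu,p)=\sum_{i=0}^{\infty}\left(\frac{\Gamma(r+i)}{i!\,\Gamma(r)}\right)^{\nu}p^i(1-p)^r .$$ A discrete random variable $X$ with $\mathrm{P}(X=k)=p_k$, $k\in\{0,1,2,\ldots\}$, follows a discrete pseudo compound Poisson distribution if its probability generating function has the form $$G(z)=\sum_{k=0}^{\infty}p_kz^k=\exp\Big\{\sum_{i=1}^{\infty}\alpha_i\lambda(z^i-1)\Big\},$$ where $\sum_{i=1}^{\infty}\alpha_i=1$, $\sum_{i=1}^{\infty}|\alpha_i|<\infty$, $\alpha_i\in\mathbb{R}$, and $\lambda>0$. *)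

theory Defs
  imports "HOL-Probability.Probability" "HOL-Real_Asymp.Real_Asymp"
begin

section \<open>The COM-negative binomial distribution\<close>

text \<open>The real exponent \<open>r\<close> of \<open>1 - p\<close> and the real exponent \<open>\<nu>\<close> are both rendered by \<open>powr\<close>;
  for \<open>r > 0\<close> and \<open>0 < p < 1\<close> all bases are positive.\<close>

definition cmnb_term :: "real \<Rightarrow> real \<Rightarrow> real \<Rightarrow> nat \<Rightarrow> real" where
  "cmnb_term r \<nu> p k =
     (Gamma (r + real k) / (fact k * Gamma r)) powr \<nu> * p ^ k * (1 - p) powr r"

definition cmnb_const :: "real \<Rightarrow> real \<Rightarrow> real \<Rightarrow> real" where
  "cmnb_const r \<nu> p = (\<Sum>i. cmnb_term r \<nu> p i)"

text \<open>Outside the range \<open>r > 0\<close>, \<open>0 < p < 1\<close> the value of \<open>cmnb_pmf\<close> carries no meaning.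
  Inside it, \<open>pmf_cmnb\<close> below shows that it has the intended probability mass function.\<close>

definition cmnb_pmf :: "real \<Rightarrow> real \<Rightarrow> real \<Rightarrow> nat pmf" where
  "cmnb_pmf r \<nu> p = embed_pmf (\<lambda>k. cmnb_term r \<nu> p k / cmnb_const r \<nu> p)"

context
  fixes r \<nu> p :: real
  assumes r: "r > 0" and p: "0 < p" "p < 1"
begin

lemma cmnb_term_pos: "cmnb_term r \<nu> p k > 0"
proof -
  have "Gamma (r + real k) > 0" "Gamma r > 0"
    using r by (auto intro!: Gamma_real_pos)
  then show ?thesis
    using p by (simp add: cmnb_term_def)
qed

lemma cmnb_term_Suc:
  "cmnb_term r \<nu> p (Suc k) = ((r + real k) / (1 + real k)) powr \<nu> * p * cmnb_term r \<nu> p k"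
proof -
  have pos: "Gamma (r + real k) > 0" "Gamma r > 0"
    using r by (auto intro!: Gamma_real_pos)
  have "r + real k \<notin> \<int>\<^sub>\<le>\<^sub>0"
    using r by (auto elim!: nonpos_Ints_cases)
  then have "Gamma (r + real (Suc k)) = (r + real k) * Gamma (r + real k)"
    using Gamma_plus1[of "r + real k"] by (simp add: add_ac)
  then have "Gamma (r + real (Suc k)) / (fact (Suc k) * Gamma r) =
      ((r + real k) / (1 + real k)) * (Gamma (r + real k) / (fact k * Gamma r))"
    by simp
  then have "(Gamma (r + real (Suc k)) / (fact (Suc k) * Gamma r)) powr \<nu> =
      ((r + real k) / (1 + real k)) powr \<nu> * (Gamma (r + real k) / (fact k * Gamma r)) powr \<nu>"
    using r pos by (simp only: powr_mult)
  then show ?thesis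
    by (simp add: cmnb_term_def)
qed

lemma summable_cmnb_term: "summable (cmnb_term r \<nu> p)"
proof -
  have "(\<lambda>k. (r + real k) / (1 + real k)) \<longlonglongrightarrow> 1"
    by real_asymp
  then have "(\<lambda>k. ((r + real k) / (1 + real k)) powr \<nu> * p) \<longlonglongrightarrow> 1 powr \<nu> * p"
    by (intro tendsto_intros) auto
  then have "\<forall>\<^sub>F k in sequentially. ((r + real k) / (1 + real k)) powr \<nu> * p < (1 + p) / 2"
    using p by (intro order_tendstoD) auto
  then obtain N where N: "((r + real k) / (1 + real k)) powr \<nu> * p < (1 + p) / 2" if "k \<ge> N" for k
    by (auto simp: eventually_sequentially)
  show ?thesis
  proof (rule summable_ratio_test[where c = "(1 + p) / 2" and N = N])
    show "(1 + p) / 2 < 1"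
      using p by simp
    show "norm (cmnb_term r \<nu> p (Suc k)) \<le> (1 + p) / 2 * norm (cmnb_term r \<nu> p k)"
      if "k \<ge> N" for k
    proof -
      have "cmnb_term r \<nu> p (Suc k) \<le> (1 + p) / 2 * cmnb_term r \<nu> p k"
        unfolding cmnb_term_Suc
        using N[OF that] cmnb_term_pos[of k] by (intro mult_right_mono) auto
      then show ?thesis
        using cmnb_term_pos[of k] cmnb_term_pos[of "Suc k"] by simp
    qed
  qed
qed

lemma cmnb_const_pos: "cmnb_const r \<nu> p > 0"
  unfolding cmnb_const_def
  by (rule suminf_pos[OF summable_cmnb_term cmnb_term_pos])

lemma pmf_cmnb: "pmf (cmnb_pmf r \<nu> p) k = cmnb_term r \<nu> p k / cmnb_const r \<nu> p"
  unfolding cmnb_pmf_def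
proof (rule pmf_embed_pmf)
  show nonneg: "0 \<le> cmnb_term r \<nu> p k / cmnb_const r \<nu> p" for k
    using cmnb_term_pos[of k] cmnb_const_pos by simp
  have "(\<lambda>k. cmnb_term r \<nu> p k / cmnb_const r \<nu> p) sums (cmnb_const r \<nu> p / cmnb_const r \<nu> p)"
    using summable_cmnb_term by (intro sums_divide) (simp add: cmnb_const_def summable_sums)
  then have "(\<lambda>k. cmnb_term r \<nu> p k / cmnb_const r \<nu> p) sums 1"
    using cmnb_const_pos by simp
  then have "(\<Sum>k. ennreal (cmnb_term r \<nu> p k / cmnb_const r \<nu> p)) = 1"
    using suminf_ennreal_eq[OF nonneg] by simp
  then show "(\<integral>\<^sup>+k. ennreal (cmnb_term r \<nu> p k / cmnb_const r \<nu> p) \<partial>count_space UNIV) = 1"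
    by (simp add: nn_integral_count_space_nat)
qed

end

section \<open>Discrete pseudo compound Poisson distributions\<close>

definition pgf :: "nat pmf \<Rightarrow> complex \<Rightarrow> complex" where
  "pgf D z = (\<Sum>k. complex_of_real (pmf D k) * z ^ k)"

text \<open>The parameters \<open>\<alpha>\<^sub>1, \<alpha>\<^sub>2, \<dots>\<close> are indexed from 1, hence the shift by \<open>Suc\<close>; the value
  \<open>\<alpha> 0\<close> is irrelevant. The identity for the probability generating function is required on the
  whole closed complex unit disc, where both series converge absolutely.\<close>

definition discrete_pseudo_compound_poisson :: "nat pmf \<Rightarrow> bool" where
  "discrete_pseudo_compound_poisson D \<longleftrightarrow>
     (\<exists>(\<alpha> :: nat \<Rightarrow> real) (rate :: real).
        rate > 0 \<and>
        summable (\<lambda>i. \<bar>\<alpha> (Suc i)\<bar>) \<and>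
        (\<Sum>i. \<alpha> (Suc i)) = 1 \<and>
        (\<forall>z. norm z \<le> 1 \<longrightarrow>
           pgf D z = exp (\<Sum>i. complex_of_real (\<alpha> (Suc i) * rate) * (z ^ Suc i - 1))))"

end

theory Submission
  imports Defs "HOL-Complex_Analysis.Complex_Analysis"
begin

text \<open>The ratio of consecutive probabilities is \<open>p ((r + k) / (1 + k))\<^sup>\<nu>\<close>, which is at most
  some \<open>q < 1\<close> in both cases (\<open>q = p\<close> if \<open>r \<le> 1\<close>, and \<open>q = p r\<^sup>\<nu>\<close>, attained at \<open>k = 0\<close>, if
  \<open>r > 1\<close>). By the argument of Enestroem and Kakeya the probability generating function \<open>G\<close> has no
  zero in the disc \<open>|z| < 1/q\<close>, so it has a holomorphic logarithm there. The Taylor coefficients of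
  \<open>log G\<close> are real and absolutely summable on the closed unit disc, and their sum from index 1 on is
  \<open>- log P(X = 0) > 0\<close>; normalising them gives \<open>\<alpha>\<close> and \<open>\<lambda>\<close>.\<close>

text \<open>Comparing coefficients in \<open>f' = f * g'\<close> yields a recursion for the
  coefficients of \<open>g\<close> of positive index, in which only the real coefficients of
  \<open>f\<close> and earlier such coefficients of \<open>g\<close> occur. Index 0 is excluded: the
  constant term of a logarithm depends on the branch and need not be real.\<close>

lemma fps_nth_log_real:
  fixes f g :: "complex \<Rightarrow> complex"
  assumes A: "open A" "0 \<in> A" and g: "g holomorphic_on A"
    and fg: "\<And>z. z \<in> A \<Longrightarrow> f z = exp (g z)"
    and F: "f has_fps_expansion F" and G: "g has_fps_expansion G"
    and real: "\<And>n. fps_nth F n \<in> \<real>"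
  shows "fps_nth G (Suc n) \<in> \<real>"
proof (induction n rule: less_induct)
  case (less n)
  have "eventually (\<lambda>z. deriv f z = f z * deriv g z) (nhds 0)"
    using eventually_nhds_in_open[OF A]
  proof eventually_elim
    case (elim z)
    have "(g has_field_derivative deriv g z) (at z)"
      using g A elim by (meson holomorphic_derivI)
    then have "((\<lambda>z. exp (g z)) has_field_derivative exp (g z) * deriv g z) (at z)"
      by (auto intro!: derivative_eq_intros)
    then have "(f has_field_derivative exp (g z) * deriv g z) (at z)"
      by (rule has_field_derivative_transform_within_open) (use A elim fg in auto)
    then show ?case
      using fg[OF elim] by (simp add: DERIV_imp_deriv)
  qed
  moreover have "deriv f has_fps_expansion fps_deriv F"
    using F by (rule has_fps_expansion_deriv)
  ultimately have "(\<lambda>z. f z * deriv g z) has_fps_expansion fps_deriv F"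
    using has_fps_expansion_cong by fast
  moreover have "(\<lambda>z. f z * deriv g z) has_fps_expansion F * fps_deriv G"
    using F G by (intro fps_expansion_intros)
  ultimately have "fps_deriv F = F * fps_deriv G"
    by (rule fps_expansion_unique_complex)
  then have "fps_nth (fps_deriv F) n = fps_nth (F * fps_deriv G) n"
    by simp
  \<comment> \<open>The term \<open>i = 0\<close> of the Cauchy product is split off because it
    alone contains the unknown \<open>fps_nth G (Suc n)\<close>. For \<open>i \<ge> 1\<close> the
    index is \<open>Suc (n - i)\<close> with \<open>n - i < n\<close>, so the induction hypothesis
    applies.\<close>
  then have eq: "of_nat (Suc n) * fps_nth F (Suc n) =
      fps_nth F 0 * (of_nat (Suc n) * fps_nth G (Suc n)) +
      (\<Sum>i=1..n. fps_nth F i * (of_nat (Suc (n - i)) * fps_nth G (Suc (n - i))))"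
    by (simp add: fps_mult_nth sum.atLeast_Suc_atMost)
  have F0: "fps_nth F 0 \<noteq> 0"
    using has_fps_expansion_imp_0_eq_fps_nth_0[OF F] fg[OF A(2)] by (metis exp_not_eq_zero)
  have S: "(\<Sum>i=1..n. fps_nth F i * (of_nat (Suc (n - i)) * fps_nth G (Suc (n - i)))) \<in> \<real>"
    using real less by (intro sum_in_Reals Reals_mult Reals_of_nat) auto
  have "fps_nth G (Suc n) = (of_nat (Suc n) * fps_nth F (Suc n) -
      (\<Sum>i=1..n. fps_nth F i * (of_nat (Suc (n - i)) * fps_nth G (Suc (n - i))))) /
      (fps_nth F 0 * of_nat (Suc n))"
    unfolding eq using F0 by (simp add: field_simps del: of_nat_Suc)
  then show ?case
    by (simp only:) (intro Reals_divide Reals_diff Reals_mult Reals_of_nat real S)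
qed

text \<open>The type of \<open>z\<close> is left general because the series is needed both at a
  complex point and at its modulus.\<close>

lemma summable_power_series_ratio_bound:
  fixes a :: "nat \<Rightarrow> real" and z :: "'a :: {real_normed_field, banach}"
  assumes "\<And>k. a k \<ge> 0" and "\<And>k. a (Suc k) \<le> q * a k" and "q * norm z < 1"
  shows "summable (\<lambda>k. of_real (a k) * z ^ k)"
proof (rule summable_ratio_test[where N = 0])
  show "norm (of_real (a (Suc k)) * z ^ Suc k) \<le> q * norm z * norm (of_real (a k) * z ^ k)" for k
  proof -
    have "a (Suc k) * norm z ^ Suc k \<le> (q * a k) * norm z ^ Suc k"
      using assms(2) by (intro mult_right_mono) auto
    then show ?thesis
      using assms(1) by (simp add: norm_mult norm_power algebra_simps)
  qed
qed fact

text \<open>Write \<open>S(w)\<close> for the series. Then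
  \<open>(1 - q w) S(w) = a 0 - (\<Sum>k. d k * w ^ Suc k)\<close> with all
  \<open>d k = q * a k - a (Suc k)\<close> nonnegative. At a zero \<open>z\<close> with
  \<open>x = norm z\<close>, the triangle inequality gives
  \<open>a 0 \<le> (\<Sum>k. d k * x ^ Suc k) = a 0 - (1 - q x) S(x)\<close>, which is impossible as
  \<open>q x < 1\<close> and \<open>S(x) > 0\<close>.\<close>

lemma power_series_nonzero_ratio_bound:
  fixes a :: "nat \<Rightarrow> real" and z :: complex
  assumes nonneg: "\<And>k. a k \<ge> 0" and "a 0 > 0" and ratio: "\<And>k. a (Suc k) \<le> q * a k"
    and z: "q * norm z < 1"
  shows "(\<Sum>k. of_real (a k) * z ^ k) \<noteq> 0"
proof
  define x where "x = norm z"
  define d where "d k = q * a k - a (Suc k)" for k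
  have expand: "(\<lambda>k. of_real (d k) * w ^ Suc k) sums
      (of_real (a 0) - (1 - of_real q * w) * (\<Sum>k. of_real (a k) * w ^ k))"
    if "norm w = x" for w :: "'a :: {real_normed_field, banach}"
  proof -
    have s: "(\<lambda>k. of_real (a k) * w ^ k) sums (\<Sum>k. of_real (a k) * w ^ k)" (is "_ sums ?S")
      using that z nonneg ratio
      by (intro summable_sums summable_power_series_ratio_bound) (auto simp: x_def)
    then have "(\<lambda>k. of_real (a (Suc k)) * w ^ Suc k) sums (?S - of_real (a 0))"
      by (subst sums_Suc_iff) simp
    moreover have "(\<lambda>k. of_real q * w * (of_real (a k) * w ^ k)) sums (of_real q * w * ?S)"
      using s by (rule sums_mult)
    ultimately have "(\<lambda>k. of_real q * w * (of_real (a k) * w ^ k) - of_real (a (Suc k)) * w ^ Suc k)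
        sums (of_real q * w * ?S - (?S - of_real (a 0)))"
      by (intro sums_diff)
    then show ?thesis
      by (simp add: d_def algebra_simps)
  qed
  have rexp: "(\<lambda>k. d k * x ^ Suc k) sums (a 0 - (1 - q * x) * (\<Sum>k. a k * x ^ k))"
    using expand[of "x :: real"] by (simp add: x_def)
  have d: "d k \<ge> 0" for k
    using ratio by (simp add: d_def)
  have norms: "norm (of_real (d k) * z ^ Suc k) = d k * x ^ Suc k" for k
    using d[of k] by (simp add: norm_mult norm_power x_def)
  assume "(\<Sum>k. of_real (a k) * z ^ k) = 0"
  then have "(\<lambda>k. of_real (d k) * z ^ Suc k) sums of_real (a 0)"
    using expand[of z] by (simp add: x_def)
  then have "of_real (a 0) = (\<Sum>k. of_real (d k) * z ^ Suc k)"
    by (simp add: sums_iff)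
  moreover have "norm (\<Sum>k. of_real (d k) * z ^ Suc k) \<le> (\<Sum>k. norm (of_real (d k) * z ^ Suc k))"
    by (rule summable_norm) (use rexp in \<open>simp only: norms sums_iff\<close>)
  moreover have "(\<Sum>k. norm (of_real (d k) * z ^ Suc k)) = a 0 - (1 - q * x) * (\<Sum>k. a k * x ^ k)"
    using rexp by (simp only: norms sums_iff)
  moreover have "norm (of_real (a 0) :: complex) = a 0"
    using nonneg by simp
  ultimately have "(1 - q * x) * (\<Sum>k. a k * x ^ k) \<le> 0"
    by simp
  moreover have "(\<Sum>k. a k * x ^ k) > 0"
  proof (rule suminf_pos2[where i = 0])
    show "summable (\<lambda>k. a k * x ^ k)"
      using summable_power_series_ratio_bound[of a q x] nonneg ratio z by (simp add: x_def)
  qed (use nonneg \<open>a 0 > 0\<close> in \<open>auto simp: x_def\<close>)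
  ultimately show False
    using z by (simp add: x_def mult_le_0_iff)
qed

text \<open>As \<open>R > 1\<close>, the Taylor series of the logarithm converges absolutely on the
  closed unit disc. Excluding the point mass at 0 makes the rate strictly positive.\<close>

lemma discrete_pseudo_compound_poisson_if_pgf_nonzero:
  fixes D :: "nat pmf"
  assumes R: "R > 1"
    and summable: "\<And>z::complex. norm z < R \<Longrightarrow> summable (\<lambda>k. of_real (pmf D k) * z ^ k)"
    and nonzero: "\<And>z. norm z < R \<Longrightarrow> pgf D z \<noteq> 0"
    and D0: "pmf D 0 \<noteq> 1"
  shows "discrete_pseudo_compound_poisson D"
proof -
  have sums: "(\<lambda>k. of_real (pmf D k) * z ^ k) sums pgf D z" if "z \<in> ball 0 R" for z
    using summable[of z] that unfolding pgf_def by (auto intro: summable_sums)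
  have pgf1: "pgf D 1 = 1"
  proof -
    have "summable (pmf D)"
      using summable[of 1] R by (simp add: summable_complex_iff)
    then have s: "pmf D sums (\<Sum>k. pmf D k)"
      by (rule summable_sums)
    have "ennreal (\<Sum>k. pmf D k) = (\<Sum>k. ennreal (pmf D k))"
      by (rule suminf_ennreal_eq[OF pmf_nonneg s, symmetric])
    also have "\<dots> = 1"
      using nn_integral_pmf_eq_1[of D] by (simp add: nn_integral_count_space_nat)
    finally have "(\<Sum>k. pmf D k) = 1"
      by simp
    with s have "(\<lambda>k. of_real (pmf D k)) sums (1::complex)"
      by (metis of_real_1 sums_of_real)
    then show ?thesis
      by (simp add: pgf_def sums_iff)
  qed
  have pgf0: "pgf D 0 = of_real (pmf D 0)"
    unfolding pgf_def by (rule sums_unique[symmetric]) (use powser_sums_zero in auto)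

  have hol: "pgf D holomorphic_on ball 0 R"
    by (rule power_series_holomorphic[where a = "\<lambda>k. of_real (pmf D k)"]) (use sums in simp)
  obtain g where g: "g holomorphic_on ball 0 R" "\<And>z. z \<in> ball 0 R \<Longrightarrow> pgf D z = exp (g z)"
    by (rule contractible_imp_holomorphic_log[OF hol convex_imp_contractible])
      (use nonzero in auto)
  \<comment> \<open>Since \<open>exp (g 1) = 1\<close>, subtracting \<open>g 1\<close> removes the
    ambiguity of the branch.\<close>
  have exp_diff: "exp (g z - g 1) = pgf D z" if "norm z < R" for z
    using g(2)[of z] g(2)[of 1] that R pgf1 by (simp add: exp_diff)

  define c where "c n = (deriv ^^ n) g 0 / fact n" for n
  have sums_g: "(\<lambda>n. c n * z ^ n) sums g z" if "norm z < R" for z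
    using holomorphic_power_series[OF g(1), of z] that by (simp add: c_def)
  have real: "c (Suc n) \<in> \<real>" for n
  proof -
    have near0: "eventually (\<lambda>z. z \<in> ball 0 R) (nhds (0::complex))"
      using R by (intro eventually_nhds_in_open) auto
    have "fps_nth (Abs_fps c) (Suc n) \<in> \<real>"
    proof (rule fps_nth_log_real)
      show "pgf D has_fps_expansion Abs_fps (\<lambda>k. of_real (pmf D k))"
        by (rule has_fps_expansionI, rule eventually_mono[OF near0]) (use sums in simp)
      show "g has_fps_expansion Abs_fps c"
        by (rule has_fps_expansionI, rule eventually_mono[OF near0]) (use sums_g in simp)
    qed (use g R in auto)
    then show ?thesis
      by simp
  qed
  \<comment> \<open>\<open>b n\<close> is the coefficient of \<open>z ^ Suc n\<close>, in line with
    the shifted indexing of \<alpha>.\<close>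
  define b where "b n = Re (c (Suc n))" for n
  have b: "c (Suc n) = of_real (b n)" for n
    using real[of n] by (simp add: b_def)
  have abs_b: "summable (\<lambda>n. \<bar>b n\<bar>)"
  proof -
    \<comment> \<open>Convergence at a point beyond 1 forces absolute convergence at 1.\<close>
    obtain w where w: "1 < w" "w < R"
      using R dense by blast
    have "summable (\<lambda>n. norm (c n * 1 ^ n))"
      by (rule powser_insidea[where x = "of_real w"])
        (use sums_g[of "of_real w"] w in \<open>auto simp: sums_iff\<close>)
    then have "summable (\<lambda>n. norm (c (Suc n)))"
      by (subst summable_Suc_iff) simp
    then show ?thesis
      by (simp add: b)
  qed
  have sums_b: "(\<lambda>n. of_real (b n) * z ^ Suc n) sums (g z - g 0)" if "norm z < R" for z
  proof -
    have "c 0 = g 0"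
      by (simp add: c_def)
    then show ?thesis
      using sums_g[OF that] unfolding b[symmetric]
      by (subst sums_Suc_iff[of "\<lambda>n. c n * z ^ n"]) simp
  qed
  define rate where "rate = (\<Sum>n. b n)"
  have "summable b"
    using abs_b by (rule summable_rabs_cancel)
  then have sums_rate: "b sums rate"
    by (simp add: rate_def summable_sums)
  have rate_eq: "of_real rate = g 1 - g 0"
    using sums_b[of 1] R sums_of_real[OF sums_rate, where 'a = complex] by (auto dest: sums_unique2)

  \<comment> \<open>\<open>exp (- rate) = pmf D 0\<close> lies strictly between 0 and 1.\<close>
  have "rate > 0"
  proof -
    have "pmf D 0 > 0"
      using nonzero[of 0] R pgf0 pmf_nonneg[of D 0] by (simp add: less_le)
    have "exp (- of_real rate) = pgf D 0"
      using exp_diff[of 0] R by (simp add: rate_eq)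
    then have "complex_of_real (exp (- rate)) = of_real (pmf D 0)"
      by (simp add: pgf0 exp_of_real[symmetric])
    then have "exp (- rate) = pmf D 0"
      by (simp only: of_real_eq_iff)
    moreover have "pmf D 0 < 1"
      using D0 pmf_le_1[of D 0] by simp
    ultimately show ?thesis
      by (metis exp_less_one_iff neg_less_0_iff_less)
  qed

  have "pgf D z = exp (\<Sum>n. of_real (b n) * (z ^ Suc n - 1))" if "norm z \<le> 1" for z
  proof -
    \<comment> \<open>Subtracting the expansion at 1 from the one at \<open>z\<close> produces the
      factors \<open>z ^ Suc n - 1\<close> and cancels \<open>g 0\<close>.\<close>
    have "(\<lambda>n. of_real (b n) * z ^ Suc n - of_real (b n) * 1 ^ Suc n) sums
        ((g z - g 0) - (g 1 - g 0))"
      using that R by (intro sums_diff sums_b) auto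
    then have "(\<Sum>n. of_real (b n) * (z ^ Suc n - 1)) = g z - g 1"
      by (simp add: sums_iff algebra_simps)
    then show ?thesis
      using exp_diff[of z] that R by simp
  qed
  moreover have "summable (\<lambda>n. \<bar>b n / rate\<bar>)"
    using abs_b by (simp add: abs_divide summable_divide)
  moreover have "(\<Sum>n. b n / rate) = 1"
    using sums_divide[OF sums_rate, of rate] \<open>rate > 0\<close> by (simp add: sums_iff)
  ultimately show ?thesis
    unfolding discrete_pseudo_compound_poisson_def using \<open>rate > 0\<close>
    \<comment> \<open>The shift \<open>n - 1\<close> turns \<alpha> at \<open>Suc i\<close> into
      \<open>b i / rate\<close>; multiplying by \<open>rate\<close> gives back
      \<open>b i\<close>.\<close>
    by (intro exI[of _ "\<lambda>n. b (n - 1) / rate"] exI[of _ rate]) simp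
qed

theorem corollary2p2:
  fixes r \<nu> p :: real
  assumes "r > 0" and "\<nu> > 0" and "0 < p" and "p < 1"
    and "(p * r powr \<nu> < 1 \<and> r > 1) \<or> r \<le> 1"
  shows "discrete_pseudo_compound_poisson (cmnb_pmf r \<nu> p)"
proof -
  define D where "D = cmnb_pmf r \<nu> p"
  \<comment> \<open>\<open>max 1 r\<close> bounds \<open>(r + k) / (1 + k)\<close> for every
    \<open>k\<close>, so a single \<open>q\<close> serves both cases of the hypothesis.\<close>
  define q where "q = p * max 1 r powr \<nu>"
  have q: "0 < q" "q < 1"
    using assms by (auto simp: q_def max_def)
  have pos: "pmf D k > 0" for k
    using assms by (simp add: D_def pmf_cmnb cmnb_term_pos cmnb_const_pos)
  have ratio: "pmf D (Suc k) \<le> q * pmf D k" for k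
  proof -
    have "r + real k \<le> max 1 r * (1 + real k)"
      using mult_right_mono[of 1 "max 1 r" "real k"] by (simp add: algebra_simps)
    then have "(r + real k) / (1 + real k) \<le> max 1 r"
      by (simp add: divide_le_eq)
    then have "((r + real k) / (1 + real k)) powr \<nu> * p \<le> q"
      using assms by (simp add: q_def powr_mono2 mult.commute)
    then have "((r + real k) / (1 + real k)) powr \<nu> * p * pmf D k \<le> q * pmf D k"
      by (rule mult_right_mono) simp
    then show ?thesis
      using assms by (simp add: D_def pmf_cmnb cmnb_term_Suc)
  qed
  have "discrete_pseudo_compound_poisson D"
  proof (rule discrete_pseudo_compound_poisson_if_pgf_nonzero)
    show "1 / q > 1"
      using q by simp
    show "summable (\<lambda>k. of_real (pmf D k) * z ^ k)" if "norm z < 1 / q" for z :: complex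
      by (rule summable_power_series_ratio_bound[where q = q])
        (use ratio that q in \<open>auto simp: field_simps\<close>)
    show "pgf D z \<noteq> 0" if "norm z < 1 / q" for z
      unfolding pgf_def
      by (rule power_series_nonzero_ratio_bound[where q = q])
        (use pos ratio that q in \<open>auto simp: field_simps\<close>)
    show "pmf D 0 \<noteq> 1"
    proof
      assume "pmf D 0 = 1"
      \<comment> \<open>The atom at 1 has positive mass, so the atom at 0 cannot carry all of
        it.\<close>
      moreover have "measure (measure_pmf D) {0, 1} = pmf D 0 + pmf D 1"
        by (simp add: measure_measure_pmf_finite)
      ultimately show False
        using pos[of 1] measure_pmf.prob_le_1[of D "{0, 1}"] by simp
    qed
  qed
  then show ?thesis
    by (simp add: D_def)
qed

end
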